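(* Let $\pi,\tau\in S_n$ with $\pi\neq\tau$. The real evolution algebra $E^n_{\pi,\tau}$ is baric if and only if there exists $k_0\in\{1,\dots,n\}$ such that one of the following conditions holds: 1) $k_0$ is a fixed point of $\pi$, $\tau(k_0)\neq k_0$, $a_{k_0k_0}\neq 0$ and $a_{\tau^{-1}(k_0)k_0}=0$ (or: $k_0$ is a fixed point of $\tau$, $\pi(k_0)\neq k_0$, $a_{k_0k_0}\neq 0$ and $a_{\pi^{-1}(k_0)k_0}=0$). In this case the corresponding weight function is $\sigma(x)=a_{k_0k_0}x_{k_0}$. 2) $k_0$ is a fixed point of both $\pi$ and $\tau$, and $a_{k_0k_0}\neq0$. In this case the corresponding weight function is $\sigma(x)=2a_{k_0k_0}x_{k_0}$.
   Context: For $\pi,\tau\in S_n$ (with $\pi\ne\tau$), $E^n_{\pi,\tau}$ denotes the $n$-dimensional algebra over $\mathbb{R}$ with basis $e_1,\dots,e_n$ (the natural basis) and multiplication $e_i\cdot e_j=0$ for $i\neq j$, and $e_i\cdot e_i=a_{i\pi(i)}e_{\pi(i)}+a_{i\tau(i)}e_{\tau(i)}$ for every $i$, where the $a_{i\pi(i)},a_{i\tau(i)}$ are real numbers (if $\pi(i)=\tau(i)$ this is a single number and $e_i\cdot e_i=2a_{i\pi(i)}e_{\pi(i)}$). Elements are written $x=\sum_i x_ie_i$. A character of a real algebra $\mathcal A$ is a nonzero algebra homomorphism $\sigma:\mathcal A\to\mathbb{R}$ (a nonzero multiplicative linear form). An algebra is called baric if it admits a character; the character is then called a weight function. *)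

theory Defs
  imports "HOL-Analysis.Analysis"
begin

definition is_character :: "('v::real_vector \<Rightarrow> 'v \<Rightarrow> 'v) \<Rightarrow> ('v \<Rightarrow> real) \<Rightarrow> bool" where
  "is_character m \<sigma> \<longleftrightarrow>
     linear \<sigma> \<and> (\<forall>x y. \<sigma> (m x y) = \<sigma> x * \<sigma> y) \<and> (\<exists>x. \<sigma> x \<noteq> 0)"

definition baric :: "('v::real_vector \<Rightarrow> 'v \<Rightarrow> 'v) \<Rightarrow> bool" where
  "baric m \<longleftrightarrow> (\<exists>\<sigma>. is_character m \<sigma>)"

(* The n-dimensional algebra lives on real ^ 'n with n = CARD('n) and natural basis axis i 1.
   Only the entries a i (p i) and a i (t i) of the coefficient family matter. The product is
   the bilinear extension of the multiplication table of the natural basis; see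
   bilinear_evol_mult and evol_mult_basis below. *)
definition evol_mult ::
  "('n::finite \<Rightarrow> 'n) \<Rightarrow> ('n \<Rightarrow> 'n) \<Rightarrow> ('n \<Rightarrow> 'n \<Rightarrow> real) \<Rightarrow> real ^ 'n \<Rightarrow> real ^ 'n \<Rightarrow> real ^ 'n"
where
  "evol_mult p t a x y =
     (\<Sum>i\<in>UNIV. (x $ i * y $ i) *\<^sub>R
        (a i (p i) *\<^sub>R axis (p i) 1 + a i (t i) *\<^sub>R axis (t i) 1))"

lemma bilinear_evol_mult: "bilinear (evol_mult p t a)"
  unfolding bilinear_def evol_mult_def
  by (auto intro!: linearI
      simp: distrib_left distrib_right scaleR_left_distrib sum.distrib scaleR_sum_right
        mult.assoc mult.left_commute simp del: scaleR_add_right)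

lemma evol_mult_basis:
  "evol_mult p t a (axis i 1) (axis j 1) =
     (if i = j then a i (p i) *\<^sub>R axis (p i) 1 + a i (t i) *\<^sub>R axis (t i) 1 else 0)"
proof -
  have "evol_mult p t a (axis i 1) (axis j 1) =
     (\<Sum>k\<in>UNIV. if k = i then (if i = j then
        a k (p k) *\<^sub>R axis (p k) 1 + a k (t k) *\<^sub>R axis (t k) 1 else 0) else 0)"
    unfolding evol_mult_def by (rule sum.cong) (auto simp: axis_def)
  then show ?thesis by simp
qed

definition one_sided_fixed ::
  "('n \<Rightarrow> 'n) \<Rightarrow> ('n \<Rightarrow> 'n) \<Rightarrow> ('n \<Rightarrow> 'n \<Rightarrow> real) \<Rightarrow> 'n \<Rightarrow> bool" where
  "one_sided_fixed p t a k \<longleftrightarrow>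
     (p k = k \<and> t k \<noteq> k \<and> a k k \<noteq> 0 \<and> a (inv t k) k = 0) \<or>
     (t k = k \<and> p k \<noteq> k \<and> a k k \<noteq> 0 \<and> a (inv p k) k = 0)"

definition common_fixed ::
  "('n \<Rightarrow> 'n) \<Rightarrow> ('n \<Rightarrow> 'n) \<Rightarrow> ('n \<Rightarrow> 'n \<Rightarrow> real) \<Rightarrow> 'n \<Rightarrow> bool" where
  "common_fixed p t a k \<longleftrightarrow> p k = k \<and> t k = k \<and> a k k \<noteq> 0"

end

theory Submission
  imports Defs
begin

text \<open>
  Products of distinct natural basis vectors vanish, so a character \<open>\<sigma>\<close> satisfies
  \<open>\<sigma> e\<^sub>i * \<sigma> e\<^sub>j = 0\<close> for \<open>i \<noteq> j\<close>: it is nonzero on exactly one basis vector \<open>e\<^sub>k\<close>, and hence a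
  multiple of the \<open>k\<close>-th coordinate. With \<open>c i k\<close> the coefficient of \<open>e\<^sub>k\<close> in \<open>e\<^sub>i * e\<^sub>i\<close>, the remaining
  equations \<open>(\<sigma> e\<^sub>i)\<^sup>2 = c i k * \<sigma> e\<^sub>k\<close> say that \<open>\<sigma> e\<^sub>k = c k k \<noteq> 0\<close> and that \<open>c i k = 0\<close> for all
  other \<open>i\<close>. Thus characters correspond to those \<open>k\<close> for which column \<open>k\<close> of the structure matrix is
  supported on its diagonal entry (\<open>is_character_iff\<close>).

  Only \<open>i = \<pi>\<inverse> k\<close> and \<open>i = \<tau>\<inverse> k\<close> can contribute to that column, so a nonzero diagonal entry forces
  \<open>k\<close> to be fixed by \<open>\<pi>\<close> or by \<open>\<tau>\<close>. If both fix \<open>k\<close>, nothing else lies in the column and the two equal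
  contributions add up to \<open>2 * a k k\<close>; if only one does, the preimage of \<open>k\<close> under the other is the one
  further place, and its coefficient has to vanish.
\<close>

definition structure_coeff ::
  "('n::finite \<Rightarrow> 'n) \<Rightarrow> ('n \<Rightarrow> 'n) \<Rightarrow> ('n \<Rightarrow> 'n \<Rightarrow> real) \<Rightarrow> 'n \<Rightarrow> 'n \<Rightarrow> real" where
  "structure_coeff p t a i k = (if p i = k then a i k else 0) + (if t i = k then a i k else 0)"

definition diagonal_column ::
  "('n::finite \<Rightarrow> 'n) \<Rightarrow> ('n \<Rightarrow> 'n) \<Rightarrow> ('n \<Rightarrow> 'n \<Rightarrow> real) \<Rightarrow> 'n \<Rightarrow> bool" where
  "diagonal_column p t a k \<longleftrightarrow>
     structure_coeff p t a k k \<noteq> 0 \<and> (\<forall>i. i \<noteq> k \<longrightarrow> structure_coeff p t a i k = 0)"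

lemma evol_mult_component:
  "evol_mult p t a x y $ k = (\<Sum>i\<in>UNIV. x $ i * y $ i * structure_coeff p t a i k)"
  unfolding evol_mult_def structure_coeff_def
  by (auto simp: axis_def intro!: sum.cong)

lemma linear_supported_on_one_axis:
  fixes \<sigma> :: "real ^ 'n::finite \<Rightarrow> real"
  assumes "linear \<sigma>" and "\<And>i. i \<noteq> k \<Longrightarrow> \<sigma> (axis i 1) = 0"
  shows "\<sigma> x = \<sigma> (axis k 1) * x $ k"
proof -
  have "\<sigma> x = \<sigma> (\<Sum>i\<in>UNIV. x $ i *\<^sub>R axis i 1)"
    using basis_expansion[of x] by (simp add: scalar_mult_eq_scaleR)
  also have "\<dots> = (\<Sum>i\<in>UNIV. x $ i * \<sigma> (axis i 1))"
    using assms(1) by (simp add: linear_sum linear_scale)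
  also have "\<dots> = (\<Sum>i\<in>UNIV. if i = k then x $ k * \<sigma> (axis k 1) else 0)"
    using assms(2) by (intro sum.cong) auto
  finally show ?thesis by simp
qed

text \<open>
  The form is multiplicative because the \<open>k\<close>-th coordinate of a product \<open>x * y\<close> collapses to
  \<open>c k k * x\<^sub>k * y\<^sub>k\<close>; the scaling factor \<open>c k k\<close> makes the two sides agree.
\<close>

lemma is_character_of_diagonal_column:
  assumes "diagonal_column p t a k"
  shows "is_character (evol_mult p t a) (\<lambda>x. structure_coeff p t a k k * x $ k)"
proof -
  let ?c = "structure_coeff p t a"
  have "evol_mult p t a x y $ k = x $ k * y $ k * ?c k k" for x y
  proof -
    have "evol_mult p t a x y $ k = (\<Sum>i\<in>UNIV. if i = k then x $ k * y $ k * ?c k k else 0)"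
      unfolding evol_mult_component
      using assms by (intro sum.cong) (auto simp: diagonal_column_def)
    then show ?thesis by simp
  qed
  moreover have "linear (\<lambda>x. ?c k k * x $ k)"
    by (rule linearI) (simp_all add: algebra_simps)
  moreover have "\<exists>x. ?c k k * x $ k \<noteq> 0"
    using assms by (intro exI[of _ "axis k 1"]) (simp add: diagonal_column_def)
  ultimately show ?thesis
    unfolding is_character_def by (simp add: mult_ac)
qed

text \<open>
  Evaluating the character at \<open>e\<^sub>i * e\<^sub>j\<close> with \<open>i \<noteq> j\<close> leaves a single basis vector on which it does
  not vanish; evaluating it at the squares \<open>e\<^sub>i * e\<^sub>i\<close> then reads off the column of that vector.
\<close>

lemma diagonal_column_of_character:
  fixes \<sigma> :: "real ^ 'n::finite \<Rightarrow> real"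
  assumes "is_character (evol_mult p t a) \<sigma>"
  obtains k where "diagonal_column p t a k" and "\<sigma> = (\<lambda>x. structure_coeff p t a k k * x $ k)"
proof -
  let ?c = "structure_coeff p t a"
  have lin: "linear \<sigma>" and mult: "\<And>x y. \<sigma> (evol_mult p t a x y) = \<sigma> x * \<sigma> y"
    and nonzero: "\<exists>x. \<sigma> x \<noteq> 0"
    using assms by (auto simp: is_character_def)
  obtain k where k: "\<sigma> (axis k 1) \<noteq> 0"
    using nonzero linear_supported_on_one_axis[OF lin] by (metis mult_zero_left)
  have "\<sigma> (axis i 1) = 0" if "i \<noteq> k" for i
    using mult[of "axis i 1" "axis k 1"] that k lin by (simp add: evol_mult_basis linear_0)
  then have coord: "\<sigma> x = \<sigma> (axis k 1) * x $ k" for x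
    by (rule linear_supported_on_one_axis[OF lin])
  have square_coord: "evol_mult p t a (axis i 1) (axis i 1) $ k = ?c i k" for i
    unfolding evol_mult_basis by (simp add: structure_coeff_def axis_def)
  have square: "(\<sigma> (axis i 1))\<^sup>2 = \<sigma> (axis k 1) * ?c i k" for i
    using mult[of "axis i 1" "axis i 1"] coord[of "evol_mult p t a (axis i 1) (axis i 1)"]
    by (simp add: square_coord power2_eq_square)
  have diag: "\<sigma> (axis k 1) = ?c k k"
    using square[of k] k by (simp add: power2_eq_square)
  have "?c i k = 0" if "i \<noteq> k" for i
    using square[of i] coord[of "axis i 1"] that k by (simp add: axis_def)
  then have "diagonal_column p t a k"
    using k diag by (auto simp: diagonal_column_def)
  moreover have "\<sigma> = (\<lambda>x. ?c k k * x $ k)"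
    using coord diag by auto
  ultimately show thesis by (rule that)
qed

theorem is_character_iff:
  "is_character (evol_mult p t a) \<sigma> \<longleftrightarrow>
     (\<exists>k. diagonal_column p t a k \<and> \<sigma> = (\<lambda>x. structure_coeff p t a k k * x $ k))"
  by (metis diagonal_column_of_character is_character_of_diagonal_column)

lemma structure_coeff_one_sided_fixed:
  "one_sided_fixed p t a k \<Longrightarrow> structure_coeff p t a k k = a k k"
  by (auto simp: one_sided_fixed_def structure_coeff_def)

lemma structure_coeff_common_fixed:
  "common_fixed p t a k \<Longrightarrow> structure_coeff p t a k k = 2 * a k k"
  by (simp add: common_fixed_def structure_coeff_def)

text \<open>
  By injectivity a map that fixes \<open>k\<close> sends no other index to \<open>k\<close>, so off the diagonal
  the column of \<open>k\<close> can only be hit at the preimage of \<open>k\<close> under a map that moves \<open>k\<close>.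
\<close>

lemma diagonal_column_iff:
  assumes "p permutes UNIV" and "t permutes UNIV"
  shows "diagonal_column p t a k \<longleftrightarrow> one_sided_fixed p t a k \<or> common_fixed p t a k"
proof -
  have p: "p i = k \<longleftrightarrow> i = inv p k" for i
    using permutes_inverses[OF assms(1)] by auto
  have t: "t i = k \<longleftrightarrow> i = inv t k" for i
    using permutes_inverses[OF assms(2)] by auto
  show ?thesis
    unfolding diagonal_column_def one_sided_fixed_def common_fixed_def structure_coeff_def p t
    by auto
qed

theorem theorem1:
  fixes \<pi> \<tau> :: "'n::finite \<Rightarrow> 'n"
    and a :: "'n \<Rightarrow> 'n \<Rightarrow> real"
  assumes "\<pi> permutes UNIV" and "\<tau> permutes UNIV" and "\<pi> \<noteq> \<tau>"
  shows "(baric (evol_mult \<pi> \<tau> a) \<longleftrightarrow>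
            (\<exists>k. one_sided_fixed \<pi> \<tau> a k \<or> common_fixed \<pi> \<tau> a k)) \<and>
         (\<forall>k. one_sided_fixed \<pi> \<tau> a k \<longrightarrow>
            is_character (evol_mult \<pi> \<tau> a) (\<lambda>x. a k k * x $ k)) \<and>
         (\<forall>k. common_fixed \<pi> \<tau> a k \<longrightarrow>
            is_character (evol_mult \<pi> \<tau> a) (\<lambda>x. 2 * a k k * x $ k)) \<and>
         (\<forall>\<sigma>. is_character (evol_mult \<pi> \<tau> a) \<sigma> \<longrightarrow>
            (\<exists>k. one_sided_fixed \<pi> \<tau> a k \<and> \<sigma> = (\<lambda>x. a k k * x $ k) \<or>
                 common_fixed \<pi> \<tau> a k \<and> \<sigma> = (\<lambda>x. 2 * a k k * x $ k)))"
proof (intro conjI allI impI)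
  show "baric (evol_mult \<pi> \<tau> a) \<longleftrightarrow>
      (\<exists>k. one_sided_fixed \<pi> \<tau> a k \<or> common_fixed \<pi> \<tau> a k)"
    unfolding baric_def is_character_iff diagonal_column_iff[OF assms(1,2)] by auto
next
  fix k assume "one_sided_fixed \<pi> \<tau> a k"
  then show "is_character (evol_mult \<pi> \<tau> a) (\<lambda>x. a k k * x $ k)"
    using is_character_of_diagonal_column[of \<pi> \<tau> a k]
    by (simp add: diagonal_column_iff[OF assms(1,2)] structure_coeff_one_sided_fixed)
next
  fix k assume "common_fixed \<pi> \<tau> a k"
  then show "is_character (evol_mult \<pi> \<tau> a) (\<lambda>x. 2 * a k k * x $ k)"
    using is_character_of_diagonal_column[of \<pi> \<tau> a k]
    by (simp add: diagonal_column_iff[OF assms(1,2)] structure_coeff_common_fixed)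
next
  fix \<sigma> assume "is_character (evol_mult \<pi> \<tau> a) \<sigma>"
  then obtain k where "diagonal_column \<pi> \<tau> a k"
    and \<sigma>: "\<sigma> = (\<lambda>x. structure_coeff \<pi> \<tau> a k k * x $ k)"
    by (rule diagonal_column_of_character)
  then consider "one_sided_fixed \<pi> \<tau> a k" | "common_fixed \<pi> \<tau> a k"
    by (auto simp: diagonal_column_iff[OF assms(1,2)])
  then show "\<exists>k. one_sided_fixed \<pi> \<tau> a k \<and> \<sigma> = (\<lambda>x. a k k * x $ k) \<or>
      common_fixed \<pi> \<tau> a k \<and> \<sigma> = (\<lambda>x. 2 * a k k * x $ k)"
    using \<sigma> by cases
      (auto simp: structure_coeff_one_sided_fixed structure_coeff_common_fixed)
qed

end
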